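(* (Splitting Lemma) Let $f:\Omega\to\mathbb{H}$ be a function defined on a slice-open subset $\Omega$ of $\mathbb{H}$. Then $f$ is slice regular if and only if for all $I,J\in\mathbb{S}$ with $I\perp J$ there exist two complex-valued holomorphic functions $F,G:\Omega_I\to\mathbb{C}_I$ such that $$f_I(z)=F(z)+G(z)J,\qquad\forall\ z\in\Omega_I.$$
   Context: $\mathbb{H}$ is the skew field of quaternions, $\mathbb{S}=\{q\in\mathbb{H}:q^2=-1\}$, and for $I\in\mathbb{S}$, $\mathbb{C}_I=\{x+yI:x,y\in\mathbb{R}\}$ with the Euclidean topology. $I\perp J$ means orthogonality in $\mathbb{H}\cong\mathbb{R}^4$. The slice-topology on $\mathbb{H}$ is the quotient topology induced by the natural map $\bigsqcup_{I\in\mathbb{S}}\mathbb{C}_I\to\mathbb{H}$; thus $\Omega$ is slice-open iff $\Omega_I:=\Omega\cap\mathbb{C}_I$ is open in $\mathbb{C}_I$ for each $I\in\mathbb{S}$. A function from an open subset of $\mathbb{C}_I$ to $\mathbb{H}$ is (left) holomorphic if it has continuous partial derivatives and $\frac12(\frac{\partial}{\partial x}+I\frac{\partial}{\partial y})f(x+yI)=0$. A function $f:\Omega\to\mathbb{H}$ on a slice-open set is (left) slice regular if $f_I:=f|_{\Omega_I}$ is left holomorphic for each $I\in\mathbb{S}$. *)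

theory Defs
  imports "HOL-Analysis.Analysis"
begin

section \<open>Quaternions\<close>

text \<open>The quaternion \<open>a + bi + cj + dk\<close> is \<open>Quat a b c d\<close>.\<close>

datatype quat = Quat (re: real) (im1: real) (im2: real) (im3: real)

lemma quat_eq_iff:
  "p = q \<longleftrightarrow> re p = re q \<and> im1 p = im1 q \<and> im2 p = im2 q \<and> im3 p = im3 q"
  by (cases p; cases q) simp

instantiation quat :: ring_1
begin

definition zero_quat where "0 = Quat 0 0 0 0"
definition one_quat where "1 = Quat 1 0 0 0"
definition plus_quat where
  "p + q = Quat (re p + re q) (im1 p + im1 q) (im2 p + im2 q) (im3 p + im3 q)"
definition minus_quat where
  "p - q = Quat (re p - re q) (im1 p - im1 q) (im2 p - im2 q) (im3 p - im3 q)"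
definition uminus_quat where
  "- p = Quat (- re p) (- im1 p) (- im2 p) (- im3 p)"
definition times_quat where
  "p * q = Quat
     (re p * re q - im1 p * im1 q - im2 p * im2 q - im3 p * im3 q)
     (re p * im1 q + im1 p * re q + im2 p * im3 q - im3 p * im2 q)
     (re p * im2 q - im1 p * im3 q + im2 p * re q + im3 p * im1 q)
     (re p * im3 q + im1 p * im2 q - im2 p * im1 q + im3 p * re q)"

instance
  by standard
    (auto simp: zero_quat_def one_quat_def plus_quat_def minus_quat_def uminus_quat_def
      times_quat_def quat_eq_iff algebra_simps)

end

lemma quat_sel_simps [simp]:
  "re 0 = 0" "im1 0 = 0" "im2 0 = 0" "im3 0 = 0"
  "re 1 = 1" "im1 1 = 0" "im2 1 = 0" "im3 1 = 0"
  "re (p + q) = re p + re q" "im1 (p + q) = im1 p + im1 q"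
  "im2 (p + q) = im2 p + im2 q" "im3 (p + q) = im3 p + im3 q"
  "re (p - q) = re p - re q" "im1 (p - q) = im1 p - im1 q"
  "im2 (p - q) = im2 p - im2 q" "im3 (p - q) = im3 p - im3 q"
  "re (- p) = - re p" "im1 (- p) = - im1 p" "im2 (- p) = - im2 p" "im3 (- p) = - im3 p"
  by (simp_all add: zero_quat_def one_quat_def plus_quat_def minus_quat_def uminus_quat_def)

lemma quat_times_sel:
  "re (p * q) = re p * re q - im1 p * im1 q - im2 p * im2 q - im3 p * im3 q"
  "im1 (p * q) = re p * im1 q + im1 p * re q + im2 p * im3 q - im3 p * im2 q"
  "im2 (p * q) = re p * im2 q - im1 p * im3 q + im2 p * re q + im3 p * im1 q"
  "im3 (p * q) = re p * im3 q + im1 p * im2 q - im2 p * im1 q + im3 p * re q"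
  by (simp_all add: times_quat_def)

instantiation quat :: real_algebra_1
begin

definition scaleR_quat where
  "r *\<^sub>R q = Quat (r * re q) (r * im1 q) (r * im2 q) (r * im3 q)"

instance
  by standard (auto simp: scaleR_quat_def quat_eq_iff quat_times_sel algebra_simps)

end

lemma quat_scaleR_sel [simp]:
  "re (r *\<^sub>R q) = r * re q" "im1 (r *\<^sub>R q) = r * im1 q"
  "im2 (r *\<^sub>R q) = r * im2 q" "im3 (r *\<^sub>R q) = r * im3 q"
  by (simp_all add: scaleR_quat_def)

lemma quat_of_real_sel [simp]:
  "re (of_real r) = r" "im1 (of_real r) = 0" "im2 (of_real r) = 0" "im3 (of_real r) = 0"
  by (simp_all add: of_real_def)

lemma quat_sum_squares_eq_0_iff:
  "(re q)\<^sup>2 + (im1 q)\<^sup>2 + (im2 q)\<^sup>2 + (im3 q)\<^sup>2 = 0 \<longleftrightarrow> q = 0"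
  by (auto simp: quat_eq_iff add_nonneg_eq_0_iff)

instantiation quat :: real_inner
begin

definition inner_quat where
  "inner p q = re p * re q + im1 p * im1 q + im2 p * im2 q + im3 p * im3 q"
definition norm_quat where "norm (q :: quat) = sqrt (inner q q)"
definition sgn_quat where "sgn (q :: quat) = q /\<^sub>R norm q"
definition dist_quat where "dist p (q :: quat) = norm (p - q)"
definition uniformity_quat where
  "(uniformity :: (quat \<times> quat) filter) = (INF e\<in>{0<..}. principal {(x, y). dist x y < e})"
definition open_quat where
  "open (U :: quat set) \<longleftrightarrow> (\<forall>x\<in>U. eventually (\<lambda>(x', y). x' = x \<longrightarrow> y \<in> U) uniformity)"

instance
proof
  fix x y z :: quat and r :: real
  show "inner x y = inner y x"
    by (simp add: inner_quat_def mult.commute)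
  show "inner (x + y) z = inner x z + inner y z" "inner (r *\<^sub>R x) y = r * inner x y"
    by (simp_all add: inner_quat_def algebra_simps)
  show "0 \<le> inner x x"
    by (simp add: inner_quat_def)
  show "inner x x = 0 \<longleftrightarrow> x = 0"
    using quat_sum_squares_eq_0_iff[of x] by (simp add: inner_quat_def power2_eq_square)
qed (rule norm_quat_def sgn_quat_def dist_quat_def uniformity_quat_def open_quat_def)+

end

instantiation quat :: real_normed_div_algebra
begin

definition inverse_quat where
  "inverse q = Quat (re q) (- im1 q) (- im2 q) (- im3 q) /\<^sub>R
     ((re q)\<^sup>2 + (im1 q)\<^sup>2 + (im2 q)\<^sup>2 + (im3 q)\<^sup>2)"
definition divide_quat where "p div (q :: quat) = p * inverse q"

instance
proof
  fix p q :: quat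
  define n where "n = (re p)\<^sup>2 + (im1 p)\<^sup>2 + (im2 p)\<^sup>2 + (im3 p)\<^sup>2"
  define c where "c = Quat (re p) (- im1 p) (- im2 p) (- im3 p)"
  have "c * p = n *\<^sub>R 1" "p * c = n *\<^sub>R 1"
    by (simp_all add: quat_eq_iff quat_times_sel n_def c_def power2_eq_square mult.commute)
  moreover have "inverse p = c /\<^sub>R n"
    by (simp add: inverse_quat_def n_def c_def)
  ultimately show "inverse p * p = 1" "p * inverse p = 1" if "p \<noteq> 0"
    using that quat_sum_squares_eq_0_iff[of p] by (simp_all add: n_def)
  show "p div q = p * inverse q"
    by (rule divide_quat_def)
  show "inverse (0 :: quat) = 0"
    by (simp add: inverse_quat_def quat_eq_iff)
  have "inner (p * q) (p * q) = inner p p * inner q q"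
    by (simp add: inner_quat_def quat_times_sel algebra_simps)
  then show "norm (p * q) = norm p * norm q"
    by (simp add: norm_quat_def real_sqrt_mult)
qed

end

instantiation quat :: euclidean_space
begin

definition Basis_quat where
  "Basis = {Quat 1 0 0 0, Quat 0 1 0 0, Quat 0 0 1 0, Quat 0 0 0 1}"

instance
proof
  fix x u v :: quat
  show "inner u v = (if u = v then 1 else 0)" if "u \<in> Basis" "v \<in> Basis"
    using that unfolding Basis_quat_def by (elim insertE emptyE) (simp_all add: inner_quat_def)
  show "(\<forall>u\<in>Basis. inner x u = 0) \<longleftrightarrow> x = 0"
    by (simp add: Basis_quat_def inner_quat_def quat_eq_iff [of x 0])
qed (simp_all add: Basis_quat_def)

end


section \<open>Slices and the slice-topology\<close>

definition imag_sphere :: "quat set" (\<open>\<S>\<close>) where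
  "\<S> = {q. q\<^sup>2 = -1}"

definition slice_plane :: "quat \<Rightarrow> quat set" where
  "slice_plane I = {of_real x + of_real y * I | x y. True}"

text \<open>
  The following is the quotient topology; see \<open>quotient_map_slice_topology\<close> below.
\<close>

definition slice_topology :: "quat topology" where
  "slice_topology =
     topology (\<lambda>U. \<forall>I\<in>\<S>. openin (top_of_set (slice_plane I)) (U \<inter> slice_plane I))"

lemma openin_slice_topology:
  "openin slice_topology U \<longleftrightarrow>
     (\<forall>I\<in>\<S>. openin (top_of_set (slice_plane I)) (U \<inter> slice_plane I))"
proof -
  have "istopology (\<lambda>U. \<forall>I\<in>\<S>. openin (top_of_set (slice_plane I)) (U \<inter> slice_plane I))"
    unfolding istopology_def
  proof (intro conjI allI impI ballI)
    fix S T I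
    assume "\<forall>I\<in>\<S>. openin (top_of_set (slice_plane I)) (S \<inter> slice_plane I)"
      and "\<forall>I\<in>\<S>. openin (top_of_set (slice_plane I)) (T \<inter> slice_plane I)" and "I \<in> \<S>"
    then have "openin (top_of_set (slice_plane I))
        ((S \<inter> slice_plane I) \<inter> (T \<inter> slice_plane I))"
      by (intro openin_Int [of _ "S \<inter> _"]) simp_all
    then show "openin (top_of_set (slice_plane I)) (S \<inter> T \<inter> slice_plane I)"
      by (simp only: Int_ac Int_left_absorb Int_absorb)
  next
    fix \<K> I
    assume "\<forall>K\<in>\<K>. \<forall>I\<in>\<S>. openin (top_of_set (slice_plane I)) (K \<inter> slice_plane I)" "I \<in> \<S>"
    then have "openin (top_of_set (slice_plane I)) (\<Union>K\<in>\<K>. K \<inter> slice_plane I)"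
      by (intro openin_Union) auto
    then show "openin (top_of_set (slice_plane I)) (\<Union>\<K> \<inter> slice_plane I)"
      by (simp only: Int_Union2)
  qed
  then show ?thesis
    by (simp add: slice_topology_def topology_inverse')
qed

lemma imag_sphere_iff: "q \<in> \<S> \<longleftrightarrow> re q = 0 \<and> norm q = 1"
proof
  assume "q \<in> \<S>"
  then have sq: "q * q = -1"
    by (simp add: imag_sphere_def power2_eq_square)
  have "re q = 0"
  proof (rule ccontr)
    assume "re q \<noteq> 0"
    moreover have "re q * im1 q = 0" "re q * im2 q = 0" "re q * im3 q = 0"
      using arg_cong[OF sq, of im1] arg_cong[OF sq, of im2] arg_cong[OF sq, of im3]
      by (auto simp: quat_times_sel)
    ultimately have "re q * re q = -1"
      using arg_cong[OF sq, of re] by (simp add: quat_times_sel)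
    then show False
      using zero_le_square[of "re q"] by linarith
  qed
  moreover have "norm q * norm q = 1"
    using arg_cong[OF sq, of norm] by (simp add: norm_mult)
  then have "norm q = 1"
    by (metis norm_ge_zero abs_of_nonneg real_sqrt_abs2 real_sqrt_one)
  ultimately show "re q = 0 \<and> norm q = 1" ..
next
  assume q: "re q = 0 \<and> norm q = 1"
  then have "re q = 0" and "im1 q * im1 q + im2 q * im2 q + im3 q * im3 q = 1"
    by (auto simp: norm_quat_def inner_quat_def)
  then show "q \<in> \<S>"
    by (simp add: imag_sphere_def power2_eq_square quat_eq_iff quat_times_sel)
qed

lemma UN_slice_plane: "(\<Union>I\<in>\<S>. slice_plane I) = UNIV"
proof -
  have "\<exists>I\<in>\<S>. q \<in> slice_plane I" for q :: quat
  proof -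
    define v where "v = Quat 0 (im1 q) (im2 q) (im3 q)"
    have q: "q = of_real (re q) + v"
      by (simp add: v_def quat_eq_iff)
    show ?thesis
    proof (cases "v = 0")
      case True
      have "Quat 0 1 0 0 \<in> \<S>"
        by (simp add: imag_sphere_iff norm_quat_def inner_quat_def)
      moreover have "q = of_real (re q) + of_real 0 * Quat 0 1 0 0"
        using q True by simp
      ultimately show ?thesis
        unfolding slice_plane_def by blast
    next
      case False
      then have "sgn v \<in> \<S>"
        by (simp add: imag_sphere_iff norm_sgn) (simp add: sgn_quat_def v_def)
      moreover have "q = of_real (re q) + of_real (norm v) * sgn v"
        using q False by (simp add: sgn_quat_def flip: scaleR_conv_of_real)
      ultimately show ?thesis
        unfolding slice_plane_def by blast
    qed
  qed
  then show ?thesis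
    by blast
qed

lemma topspace_slice_topology [simp]: "topspace slice_topology = UNIV"
proof -
  have "openin slice_topology UNIV"
    by (simp add: openin_slice_topology)
  then show ?thesis
    using openin_subset[of slice_topology UNIV] by auto
qed

lemma quotient_map_slice_topology:
  "quotient_map (sum_topology (\<lambda>I. top_of_set (slice_plane I)) \<S>) slice_topology snd"
proof -
  have "snd ` Sigma \<S> slice_plane = UNIV"
    by (simp add: snd_image_Sigma UN_slice_plane)
  moreover have "openin (sum_topology (\<lambda>I. top_of_set (slice_plane I)) \<S>)
      {x \<in> Sigma \<S> slice_plane. snd x \<in> U} \<longleftrightarrow> openin slice_topology U" for U
  proof -
    let ?V = "{x \<in> Sigma \<S> slice_plane. snd x \<in> U}"
    have "?V \<subseteq> Sigma \<S> (topspace \<circ> (\<lambda>I. top_of_set (slice_plane I)))"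
      by (rule subsetI) (simp add: o_def)
    moreover have "{x. (I, x) \<in> ?V} = U \<inter> slice_plane I" if "I \<in> \<S>" for I
      using that by auto
    ultimately show ?thesis
      by (simp only: openin_sum_topology openin_slice_topology simp_thms cong: ball_cong)
  qed
  moreover have "topspace (sum_topology (\<lambda>I. top_of_set (slice_plane I)) \<S>) = Sigma \<S> slice_plane"
    by (simp add: o_def)
  ultimately show ?thesis
    by (simp only: quotient_map_def topspace_slice_topology simp_thms)
qed

abbreviation slice_open :: "quat set \<Rightarrow> bool" where
  "slice_open \<equiv> openin slice_topology"


section \<open>Slice regular functions\<close>

text \<open>
  Functions are total on \<^typ>\<open>quat\<close>. The partial derivatives of \<open>x + yI \<mapsto> f (x + yI)\<close> at a
  point of an open subset of \<open>slice_plane I\<close> depend only on the values of \<open>f\<close> on that subset.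
\<close>

definition partial_x :: "(quat \<Rightarrow> quat) \<Rightarrow> quat \<Rightarrow> quat" where
  "partial_x f z = vector_derivative (\<lambda>t. f (z + of_real t)) (at 0)"

definition partial_y :: "quat \<Rightarrow> (quat \<Rightarrow> quat) \<Rightarrow> quat \<Rightarrow> quat" where
  "partial_y I f z = vector_derivative (\<lambda>t. f (z + of_real t * I)) (at 0)"

definition left_holomorphic_on :: "quat \<Rightarrow> quat set \<Rightarrow> (quat \<Rightarrow> quat) \<Rightarrow> bool" where
  "left_holomorphic_on I U f \<longleftrightarrow>
     openin (top_of_set (slice_plane I)) U \<and>
     (\<forall>z\<in>U. (\<lambda>t::real. f (z + of_real t)) differentiable (at 0) \<and>
             (\<lambda>t::real. f (z + of_real t * I)) differentiable (at 0)) \<and>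
     continuous_on U (partial_x f) \<and> continuous_on U (partial_y I f) \<and>
     (\<forall>z\<in>U. (1 / 2) *\<^sub>R (partial_x f z + I * partial_y I f z) = 0)"

definition slice_regular_on :: "quat set \<Rightarrow> (quat \<Rightarrow> quat) \<Rightarrow> bool" where
  "slice_regular_on \<Omega> f \<longleftrightarrow>
     slice_open \<Omega> \<and> (\<forall>I\<in>\<S>. left_holomorphic_on I (\<Omega> \<inter> slice_plane I) f)"

end

theory Submission
  imports Defs
begin

text \<open>
  For orthogonal \<open>I, J \<in> \<S>\<close> we have \<open>J * I = - I * J\<close>, so \<open>q = a + b * J\<close> with \<open>a, b\<close> in the plane
  of \<open>I\<close> gives \<open>I * q * I = - a + b * J\<close>. Hence \<open>a = (q - I * q * I) / 2\<close> and
  \<open>b = - (q + I * q * I) * J / 2\<close> are real-linear in \<open>q\<close> and commute with left multiplication by \<open>I\<close>.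
  Composition with such maps preserves the equation \<open>f\<^sub>x + I * f\<^sub>y = 0\<close>, and so do right
  multiplication by \<open>J\<close> and sums.
\<close>

text \<open>Both partial derivatives are directional derivatives, along \<open>1\<close> and along
  \<open>I\<close>. Writing the first as \<open>partial_y 1\<close> and keeping the factor
  \<open>1\<close> in \<open>of_real t * 1\<close> lets one lemma serve both directions.\<close>

lemma partial_x_eq_partial_y: "partial_x f = partial_y 1 f"
  by (rule ext) (simp add: partial_x_def partial_y_def)

lemma has_vector_derivative_partial_y:
  assumes "(\<lambda>t::real. f (z + of_real t * v)) differentiable (at 0)"
  shows "((\<lambda>t. f (z + of_real t * v)) has_vector_derivative partial_y v f z) (at 0)"
  using assms unfolding partial_y_def by (simp add: vector_derivative_works)

lemma partial_y_eqI:
  assumes "((\<lambda>t. f (z + of_real t * v)) has_vector_derivative d) (at 0)"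
  shows "partial_y v f z = d"
  using assms unfolding partial_y_def by (rule vector_derivative_at)

text \<open>Derivatives are unique, so any \<open>dx\<close> and \<open>dy\<close> found by
  differentiation rules agree with the partial derivatives on \<open>U\<close>, and continuity and
  the Cauchy-Riemann equation carry over to these.\<close>

lemma left_holomorphic_onI:
  assumes "openin (top_of_set (slice_plane I)) U"
    and "\<And>z. z \<in> U \<Longrightarrow> ((\<lambda>t. f (z + of_real t * 1)) has_vector_derivative dx z) (at 0)"
    and "\<And>z. z \<in> U \<Longrightarrow> ((\<lambda>t. f (z + of_real t * I)) has_vector_derivative dy z) (at 0)"
    and "continuous_on U dx" "continuous_on U dy"
    and "\<And>z. z \<in> U \<Longrightarrow> dx z + I * dy z = 0"
  shows "left_holomorphic_on I U f"
proof -
  have dx: "partial_x f z = dx z" and dy: "partial_y I f z = dy z" if "z \<in> U" for z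
    using that assms(2,3) by (auto simp: partial_x_eq_partial_y intro!: partial_y_eqI)
  have "(\<lambda>t. f (z + of_real t)) differentiable (at 0)"
    "(\<lambda>t. f (z + of_real t * I)) differentiable (at 0)" if "z \<in> U" for z
    using differentiableI_vector[OF assms(2)[OF that]] differentiableI_vector[OF assms(3)[OF that]]
    by simp_all
  then show ?thesis
    using assms(1,4-6) by (simp add: left_holomorphic_on_def dx dy cong: continuous_on_cong)
qed

lemma left_holomorphic_onD:
  assumes "left_holomorphic_on I U f"
  shows "openin (top_of_set (slice_plane I)) U"
    and "z \<in> U \<Longrightarrow> ((\<lambda>t. f (z + of_real t * 1)) has_vector_derivative partial_x f z) (at 0)"
    and "z \<in> U \<Longrightarrow> ((\<lambda>t. f (z + of_real t * I)) has_vector_derivative partial_y I f z) (at 0)"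
    and "continuous_on U (partial_x f)" "continuous_on U (partial_y I f)"
    and "z \<in> U \<Longrightarrow> partial_x f z + I * partial_y I f z = 0"
  using assms has_vector_derivative_partial_y[of f z 1] has_vector_derivative_partial_y[of f z I]
  by (auto simp: left_holomorphic_on_def partial_x_eq_partial_y)

text \<open>Differentiation commutes with \<open>L\<close>, and by \<open>comm\<close> the
  Cauchy-Riemann expression of the composition is \<open>L\<close> applied to that of
  \<open>f\<close>. This serves both the projections in the splitting and right multiplication by
  \<open>J\<close>.\<close>

lemma left_holomorphic_on_linear:
  assumes "left_holomorphic_on I U f" and L: "bounded_linear L"
    and comm: "\<And>q. L (I * q) = I * L q"
  shows "left_holomorphic_on I U (\<lambda>z. L (f z))"
proof (rule left_holomorphic_onI)
  note f = left_holomorphic_onD[OF assms(1)]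
  interpret L: bounded_linear L by (rule L)
  show "openin (top_of_set (slice_plane I)) U" by (rule f)
  show "((\<lambda>t. L (f (z + of_real t * 1))) has_vector_derivative L (partial_x f z)) (at 0)"
    "((\<lambda>t. L (f (z + of_real t * I))) has_vector_derivative L (partial_y I f z)) (at 0)"
    if "z \<in> U" for z
    by (rule L.has_vector_derivative f that)+
  show "continuous_on U (\<lambda>z. L (partial_x f z))" "continuous_on U (\<lambda>z. L (partial_y I f z))"
    by (rule L.continuous_on f)+
  show "L (partial_x f z) + I * L (partial_y I f z) = 0" if "z \<in> U" for z
    using arg_cong[OF f(6)[OF that], of L] by (simp add: L.add L.zero comm)
qed

lemma left_holomorphic_on_add:
  assumes "left_holomorphic_on I U f" "left_holomorphic_on I U g"
  shows "left_holomorphic_on I U (\<lambda>z. f z + g z)"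
proof (rule left_holomorphic_onI)
  note f = left_holomorphic_onD[OF assms(1)] and g = left_holomorphic_onD[OF assms(2)]
  show "openin (top_of_set (slice_plane I)) U" by (rule f)
  show "((\<lambda>t. f (z + of_real t * 1) + g (z + of_real t * 1))
      has_vector_derivative partial_x f z + partial_x g z) (at 0)"
    "((\<lambda>t. f (z + of_real t * I) + g (z + of_real t * I))
      has_vector_derivative partial_y I f z + partial_y I g z) (at 0)"
    if "z \<in> U" for z
    by (rule has_vector_derivative_add f g that)+
  show "continuous_on U (\<lambda>z. partial_x f z + partial_x g z)"
    "continuous_on U (\<lambda>z. partial_y I f z + partial_y I g z)"
    by (rule continuous_on_add f g)+
  show "(partial_x f z + partial_x g z) + I * (partial_y I f z + partial_y I g z) = 0"
    if "z \<in> U" for z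
    using arg_cong2[OF f(6)[OF that] g(6)[OF that], of "(+)"] by (simp add: algebra_simps)
qed

lemma slice_plane_add_scaled:
  assumes "z \<in> slice_plane I"
  shows "z + of_real t * 1 \<in> slice_plane I" "z + of_real t * I \<in> slice_plane I"
proof -
  obtain x y where "z = of_real x + of_real y * I"
    using assms by (auto simp: slice_plane_def)
  then have "z + of_real t * 1 = of_real (x + t) + of_real y * I"
    "z + of_real t * I = of_real x + of_real (y + t) * I"
    by (simp_all add: algebra_simps)
  then show "z + of_real t * 1 \<in> slice_plane I" "z + of_real t * I \<in> slice_plane I"
    unfolding slice_plane_def by blast+
qed

text \<open>Lines through a point of \<open>U\<close> in the directions \<open>1\<close> and
  \<open>I\<close> stay in the plane, hence in the relatively open set \<open>U\<close> for small
  \<open>t\<close>. So values outside \<open>U\<close> do not affect the derivatives.\<close>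

lemma left_holomorphic_on_transform:
  assumes "left_holomorphic_on I U f" and eq: "\<And>z. z \<in> U \<Longrightarrow> g z = f z"
  shows "left_holomorphic_on I U g"
proof (rule left_holomorphic_onI)
  note f = left_holomorphic_onD[OF assms(1)]
  show "openin (top_of_set (slice_plane I)) U" by (rule f)
  then obtain T where T: "open T" and U: "U = slice_plane I \<inter> T"
    by (auto simp: openin_open)
  have transform: "((\<lambda>t. g (z + of_real t * v)) has_vector_derivative d) (at 0)"
    if z: "z \<in> U" and v: "\<And>t. z + of_real t * v \<in> slice_plane I"
      and d: "((\<lambda>t. f (z + of_real t * v)) has_vector_derivative d) (at 0)" for z v d
  proof (rule has_vector_derivative_transform_within_open[OF d])
    \<comment> \<open>The parameters whose points lie in \<open>T\<close> form an open neighbourhood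
      of 0. By \<open>v\<close> these points also lie in the plane, thus in \<open>U\<close>, where
      \<open>eq\<close> applies.\<close>
    show "open ((\<lambda>t::real. z + of_real t * v) -` T)"
      by (intro open_vimage T continuous_intros)
    show "0 \<in> (\<lambda>t::real. z + of_real t * v) -` T"
      using z U by simp
    show "f (z + of_real t * v) = g (z + of_real t * v)"
      if "t \<in> (\<lambda>t::real. z + of_real t * v) -` T" for t
      using that v[of t] U eq by simp
  qed
  show "((\<lambda>t. g (z + of_real t * 1)) has_vector_derivative partial_x f z) (at 0)"
    "((\<lambda>t. g (z + of_real t * I)) has_vector_derivative partial_y I f z) (at 0)"
    if "z \<in> U" for z
    using that slice_plane_add_scaled[of z I] U by (intro transform f; blast)+
qed (rule left_holomorphic_onD[OF assms(1)]; assumption?)+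

lemma imag_sphere_components:
  assumes "I \<in> \<S>"
  shows "re I = 0" "im1 I * im1 I + im2 I * im2 I + im3 I * im3 I = 1"
  using assms by (auto simp: imag_sphere_iff norm_quat_def inner_quat_def)

lemma imag_sphere_square: "I \<in> \<S> \<Longrightarrow> I * I = -1"
  by (simp add: imag_sphere_def power2_eq_square)

text \<open>For purely imaginary \<open>I\<close> and \<open>J\<close> one has
  \<open>I * J + J * I = -2 * inner I J\<close>, a real number.\<close>

lemma imag_sphere_anticommute:
  assumes "I \<in> \<S>" "J \<in> \<S>" "orthogonal I J"
  shows "J * I = - (I * J)"
  using assms imag_sphere_components(1)[of I] imag_sphere_components(1)[of J]
  by (simp add: quat_eq_iff quat_times_sel orthogonal_def inner_quat_def algebra_simps)

text \<open>The commutator of \<open>q\<close> and \<open>I\<close> is twice the cross product of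
  their imaginary parts. If it vanishes, the imaginary part of \<open>q\<close> is a multiple of
  \<open>I\<close>.\<close>

lemma slice_planeI_commute:
  assumes "I \<in> \<S>" "q * I = I * q"
  shows "q \<in> slice_plane I"
proof -
  note I = imag_sphere_components[OF assms(1)]
  have par: "im2 q * im3 I = im3 q * im2 I" "im3 q * im1 I = im1 q * im3 I"
    "im1 q * im2 I = im2 q * im1 I"
    using assms(2) I(1) by (simp_all add: quat_eq_iff quat_times_sel algebra_simps)
  \<comment> \<open>As \<open>I\<close> is a unit vector, the multiple is the inner product of
    \<open>I\<close> with the imaginary part of \<open>q\<close>.\<close>
  define y where "y = im1 q * im1 I + im2 q * im2 I + im3 q * im3 I"
  have "y * im1 I = im1 q" "y * im2 I = im2 q" "y * im3 I = im3 q"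
    using par I(2) unfolding y_def by algebra+
  then have "q = of_real (re q) + of_real y * I"
    using I(1) by (simp add: quat_eq_iff quat_times_sel)
  then show ?thesis
    unfolding slice_plane_def by blast
qed

lemma ex_orthogonal_imag_sphere:
  assumes "I \<in> \<S>"
  obtains J where "J \<in> \<S>" "orthogonal I J"
proof -
  \<comment> \<open>A quarter turn of the first two imaginary components is orthogonal to
    \<open>I\<close>. It vanishes when \<open>I\<close> has only a third component, and then the
    first unit vector serves.\<close>
  define v where "v = (if im1 I = 0 \<and> im2 I = 0 then Quat 0 1 0 0 else Quat 0 (- im2 I) (im1 I) 0)"
  have v: "v \<noteq> 0" "re v = 0" "orthogonal I v"
    by (auto simp: v_def quat_eq_iff orthogonal_def inner_quat_def)
  then have "sgn v \<in> \<S>" "orthogonal I (sgn v)"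
    by (auto simp: imag_sphere_iff norm_sgn orthogonal_def) (simp_all add: sgn_div_norm)
  then show thesis
    by (rule that)
qed

lemma left_holomorphic_on_split:
  assumes I: "I \<in> \<S>" and J: "J \<in> \<S>" and IJ: "orthogonal I J"
    and f: "left_holomorphic_on I U f"
  obtains F G where "F \<in> U \<rightarrow> slice_plane I" "G \<in> U \<rightarrow> slice_plane I"
    "left_holomorphic_on I U F" "left_holomorphic_on I U G"
    "\<And>z. f z = F z + G z * J"
proof
  define P where "P q = (1/2) *\<^sub>R (q - I * q * I)" for q
  define Q where "Q q = - (1/2) *\<^sub>R ((q + I * q * I) * J)" for q
  have II: "I * I = -1" and JJ: "J * J = -1" and JI: "J * I = - (I * J)"
    using assms by (simp_all add: imag_sphere_square imag_sphere_anticommute)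
  \<comment> \<open>With products nested to the right, these rules move each \<open>I\<close> in
    front of each \<open>J\<close> and cancel squares in the middle of a product.\<close>
  have left: "I * (I * q) = - q" "J * (J * q) = - q" "J * (I * q) = - (I * (J * q))" for q
    by (simp_all add: II JJ JI flip: mult.assoc)
  have "bounded_linear P" "bounded_linear Q"
    unfolding P_def Q_def by (intro bounded_linear_intros)+
  moreover have "P (I * q) = I * P q" "Q (I * q) = I * Q q" for q
    by (simp_all add: P_def Q_def algebra_simps left II)
  ultimately show "left_holomorphic_on I U (\<lambda>z. P (f z))" "left_holomorphic_on I U (\<lambda>z. Q (f z))"
    using f left_holomorphic_on_linear[of I U f P] left_holomorphic_on_linear[of I U f Q] by blast+
  \<comment> \<open>Membership in the plane reduces to commuting with \<open>I\<close>: both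
    \<open>P q * I\<close> and \<open>I * P q\<close> equal
    \<open>(1/2) *\<^sub>R (I * q + q * I)\<close>, and for \<open>Q\<close> the sign from
    \<open>J * I = - (I * J)\<close> enters.\<close>
  have "P q \<in> slice_plane I" "Q q \<in> slice_plane I" for q
    by (rule slice_planeI_commute[OF I],
        simp add: P_def Q_def algebra_simps mult.assoc left II JJ JI)+
  then show "(\<lambda>z. P (f z)) \<in> U \<rightarrow> slice_plane I" "(\<lambda>z. Q (f z)) \<in> U \<rightarrow> slice_plane I"
    by simp_all
  \<comment> \<open>Since \<open>J * J = -1\<close>, the product \<open>Q q * J\<close> is half of
    \<open>q + I * q * I\<close>, so the terms \<open>I * q * I\<close> cancel.\<close>
  have "P q + Q q * J = (1/2) *\<^sub>R (q + q)" for q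
    by (simp add: P_def Q_def algebra_simps mult.assoc JJ)
  then show "f z = P (f z) + Q (f z) * J" for z
    by (simp add: scaleR_half_double)
qed

theorem lemma4p2:
  fixes \<Omega> :: "quat set" and f :: "quat \<Rightarrow> quat"
  assumes "slice_open \<Omega>"
  shows "slice_regular_on \<Omega> f \<longleftrightarrow>
    (\<forall>I\<in>\<S>. \<forall>J\<in>\<S>. orthogonal I J \<longrightarrow>
      (\<exists>F G. F \<in> \<Omega> \<inter> slice_plane I \<rightarrow> slice_plane I \<and>
             G \<in> \<Omega> \<inter> slice_plane I \<rightarrow> slice_plane I \<and>
             left_holomorphic_on I (\<Omega> \<inter> slice_plane I) F \<and>
             left_holomorphic_on I (\<Omega> \<inter> slice_plane I) G \<and>
             (\<forall>z \<in> \<Omega> \<inter> slice_plane I. f z = F z + G z * J)))"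
    (is "_ \<longleftrightarrow> (\<forall>I\<in>\<S>. \<forall>J\<in>\<S>. orthogonal I J \<longrightarrow> ?split I J)")
proof
  assume "slice_regular_on \<Omega> f"
  then have f: "left_holomorphic_on I (\<Omega> \<inter> slice_plane I) f" if "I \<in> \<S>" for I
    using that by (simp add: slice_regular_on_def)
  show "\<forall>I\<in>\<S>. \<forall>J\<in>\<S>. orthogonal I J \<longrightarrow> ?split I J"
  proof (intro ballI impI)
    fix I J assume IJ: "I \<in> \<S>" "J \<in> \<S>" "orthogonal I J"
    obtain F G where "F \<in> \<Omega> \<inter> slice_plane I \<rightarrow> slice_plane I" "G \<in> \<Omega> \<inter> slice_plane I \<rightarrow> slice_plane I"
      "left_holomorphic_on I (\<Omega> \<inter> slice_plane I) F" "left_holomorphic_on I (\<Omega> \<inter> slice_plane I) G"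
      "\<And>z. f z = F z + G z * J"
      using IJ f[OF IJ(1)] by (rule left_holomorphic_on_split) blast
    then show "?split I J"
      by blast
  qed
next
  assume split: "\<forall>I\<in>\<S>. \<forall>J\<in>\<S>. orthogonal I J \<longrightarrow> ?split I J"
  have "left_holomorphic_on I (\<Omega> \<inter> slice_plane I) f" if I: "I \<in> \<S>" for I
  proof -
    \<comment> \<open>The hypothesis speaks of pairs, so it says something about \<open>I\<close>
      only once some orthogonal \<open>J\<close> exists.\<close>
    obtain J where "J \<in> \<S>" "orthogonal I J"
      using I by (rule ex_orthogonal_imag_sphere)
    then obtain F G where F: "left_holomorphic_on I (\<Omega> \<inter> slice_plane I) F"
      and G: "left_holomorphic_on I (\<Omega> \<inter> slice_plane I) G"
      and eq: "\<And>z. z \<in> \<Omega> \<inter> slice_plane I \<Longrightarrow> f z = F z + G z * J"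
      using split I by meson
    \<comment> \<open>Right multiplication by \<open>J\<close> commutes with left multiplication by
      \<open>I\<close> by associativity.\<close>
    have "left_holomorphic_on I (\<Omega> \<inter> slice_plane I) (\<lambda>z. G z * J)"
      using G by (rule left_holomorphic_on_linear) (simp_all add: bounded_linear_mult_left mult.assoc)
    with F have "left_holomorphic_on I (\<Omega> \<inter> slice_plane I) (\<lambda>z. F z + G z * J)"
      by (rule left_holomorphic_on_add)
    then show ?thesis
      using eq by (rule left_holomorphic_on_transform)
  qed
  with assms show "slice_regular_on \<Omega> f"
    by (simp add: slice_regular_on_def)
qed

end
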